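(* Let $X$ be an infinite dimensional Archimedean vector lattice with order units. Then there is a net $(x_\alpha)_{\alpha\in A}$ in $X$ such that $x_\alpha\downarrow 0$, but $(x_\alpha)_{\alpha\in A}$ does not converge to $0$ with respect to the order bound topology $\tau_{ob}$.
   Context: A partially ordered vector space is a real vector space $X$ with a partial order $\leq$ such that $x\leq y$ implies $x+z\leq y+z$ and $\lambda x\leq\lambda y$ for all $z\in X$ and real $\lambda\geq 0$; $X_+=\{x\in X;\ x\geq 0\}$, and order intervals are the sets $[x,y]=\{z\in X;\ x\leq z\leq y\}$. It is a vector lattice if every non-empty finite subset has an infimum and a supremum. $X$ is Archimedean if for all $x,y\in X$ with $nx\leq y$ for all $n\in\mathbb{N}$ one has $x\leq 0$. An element $u\in X_+$ is an order unit if for every $x\in X$ there is $n\in\mathbb{N}$ with $x\leq nu$. For a net we write $x_\alpha\downarrow 0$ if the net is decreasing ($\alpha\leq\beta$ implies $x_\beta\leq x_\alpha$) and $\inf_{\alpha\in A} x_\alpha=0$. A set $M\subseteq X$ is circled if $\lambda M\subseteq M$ for all $\lambda\in[-1,1]$; $M$ absorbs $N\subseteq X$ if there is $\mu>0$ with $\lambda N\subseteq M$ for all $\lambda\in[-\mu,\mu]$. Let $\mathcal{B}_{ob}$ be the set of all convex, circled $V\subseteq X$ that absorb all order intervals. The order bound topology $\tau_{ob}$ is the vector space topology on $X$ for which $\mathcal{B}_{ob}$ is a base of neighbourhoods at $0$. *)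

theory Defs
  imports "HOL-Analysis.Analysis" "HOL-Library.Lub_Glb"
begin

definition infinite_dimensional :: "'a::real_vector itself \<Rightarrow> bool" where
  "infinite_dimensional _ \<longleftrightarrow> \<not> (\<exists>B::'a set. finite B \<and> span B = UNIV)"

text \<open>Here \<open>n = 0\<close> is included, which makes no difference in a vector lattice: if \<open>n x \<le> y\<close> for
  all \<open>n \<ge> 1\<close>, then \<open>n x \<le> sup y 0\<close> for all \<open>n\<close>.\<close>

definition archimedean_order :: "'a::ordered_real_vector itself \<Rightarrow> bool" where
  "archimedean_order _ \<longleftrightarrow>
     (\<forall>x y::'a. (\<forall>n::nat. real n *\<^sub>R x \<le> y) \<longrightarrow> x \<le> 0)"

definition order_unit :: "'a::ordered_real_vector \<Rightarrow> bool" where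
  "order_unit u \<longleftrightarrow> 0 \<le> u \<and> (\<forall>x. \<exists>n::nat. x \<le> real n *\<^sub>R u)"

definition circled :: "'a::real_vector set \<Rightarrow> bool" where
  "circled M \<longleftrightarrow> (\<forall>c\<in>{-1..1}. (\<lambda>x. c *\<^sub>R x) ` M \<subseteq> M)"

definition absorbs :: "'a::real_vector set \<Rightarrow> 'a set \<Rightarrow> bool" where
  "absorbs M N \<longleftrightarrow> (\<exists>\<mu>>0. \<forall>c\<in>{-\<mu>..\<mu>}. (\<lambda>x. c *\<^sub>R x) ` N \<subseteq> M)"

definition order_bound_base :: "'a::ordered_real_vector set set" where
  "order_bound_base = {V. convex V \<and> circled V \<and> (\<forall>x y. absorbs V {x..y})}"

text \<open>The translation-invariant topology with neighbourhood base \<^const>\<open>order_bound_base\<close>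
  at \<open>0\<close>. That this is a vector space topology with that base is shown below.\<close>

definition order_bound_topology :: "'a::ordered_real_vector topology" where
  "order_bound_topology =
     topology (\<lambda>U. \<forall>x\<in>U. \<exists>V\<in>order_bound_base. (\<lambda>v. x + v) ` V \<subseteq> U)"

text \<open>Index orders are relations; \<open>(a, b) \<in> r\<close> reads \<open>a \<le> b\<close>.\<close>

definition directed_on :: "'i set \<Rightarrow> 'i rel \<Rightarrow> bool" where
  "directed_on A r \<longleftrightarrow> A \<noteq> {} \<and> preorder_on A r \<and>
     (\<forall>a\<in>A. \<forall>b\<in>A. \<exists>c\<in>A. (a, c) \<in> r \<and> (b, c) \<in> r)"

text \<open>The filter on the index set that is generated by the tails of a directed set; for directed
  \<open>A\<close>, convergence of the net \<open>x\<close> along this filter is the usual convergence of nets.\<close>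

definition net_filter :: "'i set \<Rightarrow> 'i rel \<Rightarrow> 'i filter" where
  "net_filter A r = (INF a\<in>A. principal {b\<in>A. (a, b) \<in> r})"

definition net_decreases_to_0 ::
  "'i set \<Rightarrow> 'i rel \<Rightarrow> ('i \<Rightarrow> 'a::ordered_real_vector) \<Rightarrow> bool" where
  "net_decreases_to_0 A r x \<longleftrightarrow>
     (\<forall>a\<in>A. \<forall>b\<in>A. (a, b) \<in> r \<longrightarrow> x b \<le> x a) \<and> isGlb UNIV (x ` A) 0"

lemma isGlb_UNIV_iff:
  fixes g :: "'a::order"
  shows "isGlb UNIV S g \<longleftrightarrow> (\<forall>s\<in>S. g \<le> s) \<and> (\<forall>z. (\<forall>s\<in>S. z \<le> s) \<longrightarrow> z \<le> g)"
  by (auto simp: isGlb_def greatestP_def isLb_def setge_def setle_def)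

lemma eventually_net_filter:
  assumes "directed_on A r"
  shows "eventually P (net_filter A r) \<longleftrightarrow> (\<exists>a\<in>A. \<forall>b\<in>A. (a, b) \<in> r \<longrightarrow> P b)"
proof -
  have tr: "trans r" using assms by (auto simp: directed_on_def preorder_on_def)
  have "eventually P (net_filter A r) \<longleftrightarrow>
      (\<exists>a\<in>A. eventually P (principal {b\<in>A. (a, b) \<in> r}))"
    unfolding net_filter_def
  proof (rule eventually_INF_base)
    show "A \<noteq> {}" using assms by (simp add: directed_on_def)
  next
    fix a b assume "a \<in> A" "b \<in> A"
    then obtain c where c: "c \<in> A" "(a, c) \<in> r" "(b, c) \<in> r"
      using assms unfolding directed_on_def by blast
    have "principal {d\<in>A. (c, d) \<in> r} \<le>
        inf (principal {d\<in>A. (a, d) \<in> r}) (principal {d\<in>A. (b, d) \<in> r})"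
      using c tr by (auto dest: transD)
    with c show "\<exists>x\<in>A. principal {d\<in>A. (x, d) \<in> r} \<le>
        inf (principal {d\<in>A. (a, d) \<in> r}) (principal {d\<in>A. (b, d) \<in> r})" by blast
  qed
  then show ?thesis by (auto simp: eventually_principal)
qed

lemma circledD: "circled V \<Longrightarrow> x \<in> V \<Longrightarrow> \<bar>c\<bar> \<le> 1 \<Longrightarrow> c *\<^sub>R x \<in> V"
  unfolding circled_def by (auto simp: abs_le_iff image_subset_iff)

lemma order_bound_base_Int:
  fixes V W :: "'a::ordered_real_vector set"
  assumes "V \<in> order_bound_base" "W \<in> order_bound_base"
  shows "V \<inter> W \<in> order_bound_base"
proof -
  have "absorbs (V \<inter> W) N" if "absorbs V N" "absorbs W N" for N
  proof -
    from that obtain m k where mk: "m > 0" "k > 0"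
      "\<forall>c\<in>{-m..m}. (\<lambda>x. c *\<^sub>R x) ` N \<subseteq> V" "\<forall>c\<in>{-k..k}. (\<lambda>x. c *\<^sub>R x) ` N \<subseteq> W"
      unfolding absorbs_def by blast
    show ?thesis
      unfolding absorbs_def
    proof (intro exI[of _ "min m k"] conjI ballI)
      show "min m k > 0" using mk by simp
    next
      fix c assume "c \<in> {- min m k..min m k}"
      then have "c \<in> {-m..m}" "c \<in> {-k..k}" by (auto simp: min_def split: if_splits)
      with mk show "(\<lambda>x. c *\<^sub>R x) ` N \<subseteq> V \<inter> W" by blast
    qed
  qed
  moreover have "circled (V \<inter> W)" if "circled V" "circled W"
    using that unfolding circled_def by blast
  ultimately show ?thesis
    using assms unfolding order_bound_base_def by (auto intro: convex_Int)
qed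

lemma order_bound_base_UNIV: "UNIV \<in> (order_bound_base :: 'a::ordered_real_vector set set)"
  unfolding order_bound_base_def circled_def absorbs_def by (auto intro: exI[of _ 1])

lemma order_bound_base_absorbs_point:
  fixes x :: "'a::ordered_real_vector"
  assumes "V \<in> order_bound_base"
  obtains \<mu> where "\<mu> > 0" "\<And>c. \<bar>c\<bar> \<le> \<mu> \<Longrightarrow> c *\<^sub>R x \<in> V"
proof -
  have "absorbs V {x..x}" using assms unfolding order_bound_base_def by blast
  then obtain \<mu> where "\<mu> > 0" "\<forall>c\<in>{-\<mu>..\<mu>}. (\<lambda>x. c *\<^sub>R x) ` {x..x} \<subseteq> V"
    unfolding absorbs_def by blast
  then show thesis by (intro that[of \<mu>]) (auto simp: abs_le_iff)
qed

lemma zero_in_order_bound_base: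
  fixes V :: "'a::ordered_real_vector set"
  assumes "V \<in> order_bound_base"
  shows "0 \<in> V"
  using order_bound_base_absorbs_point[OF assms, of 0] by (metis abs_zero less_imp_le scaleR_zero_left)

lemma order_bound_base_scale:
  fixes V :: "'a::ordered_real_vector set"
  assumes "V \<in> order_bound_base" "c > 0"
  shows "(\<lambda>x. c *\<^sub>R x) ` V \<in> order_bound_base"
proof -
  have "circled ((\<lambda>x. c *\<^sub>R x) ` V)"
    unfolding circled_def
  proof (intro ballI subsetI)
    fix d :: real and y assume d: "d \<in> {-1..1}" "y \<in> (\<lambda>x. d *\<^sub>R x) ` (\<lambda>x. c *\<^sub>R x) ` V"
    then obtain v where v: "v \<in> V" "y = c *\<^sub>R (d *\<^sub>R v)" by (auto simp: mult.commute)
    moreover have "d *\<^sub>R v \<in> V"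
      using assms v d by (intro circledD) (auto simp: order_bound_base_def abs_le_iff)
    ultimately show "y \<in> (\<lambda>x. c *\<^sub>R x) ` V" by blast
  qed
  moreover have "absorbs ((\<lambda>x. c *\<^sub>R x) ` V) N" if N: "absorbs V N" for N
  proof -
    from N obtain m where m: "m > 0" "\<forall>d\<in>{-m..m}. (\<lambda>x. d *\<^sub>R x) ` N \<subseteq> V"
      unfolding absorbs_def by blast
    have "(\<lambda>x. d *\<^sub>R x) ` N \<subseteq> (\<lambda>x. c *\<^sub>R x) ` V" if "d \<in> {-(c*m)..c*m}" for d
    proof
      fix y assume "y \<in> (\<lambda>x. d *\<^sub>R x) ` N"
      then obtain n where n: "n \<in> N" "y = d *\<^sub>R n" by blast
      have "d / c \<in> {-m..m}" using that assms(2) by (auto simp: field_simps)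
      then have "(d / c) *\<^sub>R n \<in> V" using m n by blast
      moreover have "y = c *\<^sub>R ((d / c) *\<^sub>R n)" using n assms(2) by simp
      ultimately show "y \<in> (\<lambda>x. c *\<^sub>R x) ` V" by blast
    qed
    then show ?thesis
      unfolding absorbs_def using m assms(2) by (intro exI[of _ "c * m"]) auto
  qed
  ultimately show ?thesis
    using assms unfolding order_bound_base_def by (auto intro: convex_scaling)
qed

lemma openin_order_bound_topology:
  "openin order_bound_topology U \<longleftrightarrow>
     (\<forall>x\<in>U. \<exists>V\<in>order_bound_base. (\<lambda>v. x + v) ` V \<subseteq> U)"
proof -
  have "istopology (\<lambda>U::'a set. \<forall>x\<in>U. \<exists>V\<in>order_bound_base. (\<lambda>v. x + v) ` V \<subseteq> U)"
    unfolding istopology_def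
  proof (intro conjI allI impI ballI)
    fix S T :: "'a set" and x
    assume *: "\<forall>x\<in>S. \<exists>V\<in>order_bound_base. (\<lambda>v. x + v) ` V \<subseteq> S"
      "\<forall>x\<in>T. \<exists>V\<in>order_bound_base. (\<lambda>v. x + v) ` V \<subseteq> T" "x \<in> S \<inter> T"
    then obtain V W where "V \<in> order_bound_base" "W \<in> order_bound_base"
      "(\<lambda>v. x + v) ` V \<subseteq> S" "(\<lambda>v. x + v) ` W \<subseteq> T" by blast
    then show "\<exists>V\<in>order_bound_base. (\<lambda>v. x + v) ` V \<subseteq> S \<inter> T"
      by (intro bexI[of _ "V \<inter> W"] order_bound_base_Int) auto
  next
    fix K :: "'a set set" and x
    assume *: "\<forall>U\<in>K. \<forall>x\<in>U. \<exists>V\<in>order_bound_base. (\<lambda>v. x + v) ` V \<subseteq> U" "x \<in> \<Union>K"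
    then show "\<exists>V\<in>order_bound_base. (\<lambda>v. x + v) ` V \<subseteq> \<Union>K"
      by (meson UnionE Union_upper subset_trans)
  qed
  then show ?thesis by (simp add: order_bound_topology_def)
qed

lemma topspace_order_bound_topology [simp]: "topspace order_bound_topology = UNIV"
proof -
  have "openin order_bound_topology (UNIV :: 'a set)"
    unfolding openin_order_bound_topology using order_bound_base_UNIV by blast
  then show ?thesis using openin_subset by blast
qed

lemma openin_order_bound_interior:
  fixes V :: "'a::ordered_real_vector set"
  assumes "V \<in> order_bound_base"
  shows "\<exists>U. openin order_bound_topology U \<and> 0 \<in> U \<and> U \<subseteq> V"
proof (intro exI conjI)
  let ?U = "{x. \<exists>W\<in>order_bound_base. (\<lambda>v. x + v) ` W \<subseteq> V}"
  show "0 \<in> ?U" using assms by auto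
  show "?U \<subseteq> V" using zero_in_order_bound_base by force
  show "openin order_bound_topology ?U"
    unfolding openin_order_bound_topology
  proof
    fix x assume "x \<in> ?U"
    then obtain W where W: "W \<in> order_bound_base" "(\<lambda>v. x + v) ` W \<subseteq> V" by blast
    let ?H = "(\<lambda>w. (1/2) *\<^sub>R w) ` W"
    have H: "?H \<in> order_bound_base" using W by (intro order_bound_base_scale) auto
    have "(\<lambda>v. x + h + v) ` ?H \<subseteq> V" if "h \<in> ?H" for h
    proof -
      have "h + k \<in> W" if k: "k \<in> ?H" for k
      proof -
        obtain a b where "a \<in> W" "b \<in> W" "h = (1/2) *\<^sub>R a" "k = (1/2) *\<^sub>R b"
          using \<open>h \<in> ?H\<close> k by blast
        moreover have "convex W" using W by (simp add: order_bound_base_def)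
        ultimately show ?thesis by (auto intro: convexD)
      qed
      then show ?thesis using W by (force simp: add.assoc)
    qed
    then show "\<exists>V'\<in>order_bound_base. (\<lambda>v. x + v) ` V' \<subseteq> ?U"
      using H by blast
  qed
qed

lemma order_bound_nhds_0:
  "(\<exists>U. openin order_bound_topology U \<and> 0 \<in> U \<and> U \<subseteq> N) \<longleftrightarrow> (\<exists>V\<in>order_bound_base. V \<subseteq> N)"
proof
  assume "\<exists>U. openin order_bound_topology U \<and> 0 \<in> U \<and> U \<subseteq> N"
  then obtain U V where U: "U \<subseteq> N" and V: "V \<in> order_bound_base" "(\<lambda>v. 0 + v) ` V \<subseteq> U"
    unfolding openin_order_bound_topology by blast
  then show "\<exists>V\<in>order_bound_base. V \<subseteq> N" by (intro bexI[OF _ V(1)]) auto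
next
  assume "\<exists>V\<in>order_bound_base. V \<subseteq> N"
  then show "\<exists>U. openin order_bound_topology U \<and> 0 \<in> U \<and> U \<subseteq> N"
    using openin_order_bound_interior by (meson subset_trans)
qed

lemma order_bound_nhd_at:
  fixes x :: "'a::ordered_real_vector"
  assumes "V \<in> order_bound_base"
  obtains U where "openin order_bound_topology U" "x \<in> U" "U \<subseteq> (\<lambda>v. x + v) ` V"
proof -
  obtain U where U: "openin order_bound_topology U" "0 \<in> U" "U \<subseteq> V"
    using openin_order_bound_interior[OF assms] by blast
  have "openin order_bound_topology ((\<lambda>v. x + v) ` U)"
    unfolding openin_order_bound_topology
  proof
    fix z assume "z \<in> (\<lambda>v. x + v) ` U"
    then obtain u where u: "u \<in> U" "z = x + u" by blast
    then obtain W where W: "W \<in> order_bound_base" "(\<lambda>v. u + v) ` W \<subseteq> U"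
      using U unfolding openin_order_bound_topology by blast
    then show "\<exists>V\<in>order_bound_base. (\<lambda>v. z + v) ` V \<subseteq> (\<lambda>v. x + v) ` U"
      using u by (intro bexI[OF _ W(1)]) (force simp: add.assoc)
  qed
  moreover have "x \<in> (\<lambda>v. x + v) ` U" using U by force
  ultimately show thesis using U by (intro that[of "(\<lambda>v. x + v) ` U"]) auto
qed

lemma order_bound_topology_add:
  "continuous_map (prod_topology order_bound_topology order_bound_topology)
     order_bound_topology (\<lambda>(x, y). x + y :: 'a::ordered_real_vector)"
  unfolding continuous_map_def
proof (intro conjI allI impI)
  fix U :: "'a set" assume U: "openin order_bound_topology U"
  have "\<exists>P Q. openin order_bound_topology P \<and> openin order_bound_topology Q \<and> x \<in> P \<and> y \<in> Q \<and>
      P \<times> Q \<subseteq> {(x, y). x + y \<in> U}" if xy: "x + y \<in> U" for x y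
  proof -
    obtain V where V: "V \<in> order_bound_base" "(\<lambda>v. x + y + v) ` V \<subseteq> U"
      using U xy unfolding openin_order_bound_topology by blast
    let ?H = "(\<lambda>w. (1/2) *\<^sub>R w) ` V"
    have H: "?H \<in> order_bound_base" using V by (intro order_bound_base_scale) auto
    obtain P where P: "openin order_bound_topology P" "x \<in> P" "P \<subseteq> (\<lambda>v. x + v) ` ?H"
      using order_bound_nhd_at[OF H] by blast
    obtain Q where Q: "openin order_bound_topology Q" "y \<in> Q" "Q \<subseteq> (\<lambda>v. y + v) ` ?H"
      using order_bound_nhd_at[OF H] by blast
    have "p + q \<in> U" if pq: "p \<in> P" "q \<in> Q" for p q
    proof -
      obtain a b where ab: "a \<in> V" "b \<in> V" "p = x + (1/2) *\<^sub>R a" "q = y + (1/2) *\<^sub>R b"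
        using P Q pq by blast
      have "(1/2) *\<^sub>R a + (1/2) *\<^sub>R b \<in> V"
        using V ab by (auto simp: order_bound_base_def intro: convexD)
      moreover have "p + q = x + y + ((1/2) *\<^sub>R a + (1/2) *\<^sub>R b)" using ab by simp
      ultimately show ?thesis using V by (metis imageI subsetD)
    qed
    with P Q show ?thesis by (intro exI[of _ P] exI[of _ Q]) auto
  qed
  then show "openin (prod_topology order_bound_topology order_bound_topology)
      {z \<in> topspace (prod_topology order_bound_topology order_bound_topology).
        (case z of (x, y) \<Rightarrow> x + y) \<in> U}"
    by (subst openin_prod_topology_alt) (auto simp: subset_iff)
qed auto

lemma order_bound_topology_scaleR:
  "continuous_map (prod_topology euclideanreal order_bound_topology)
     order_bound_topology (\<lambda>(c, x). c *\<^sub>R x :: 'a::ordered_real_vector)"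
  unfolding continuous_map_def
proof (intro conjI allI impI)
  fix U :: "'a set" assume U: "openin order_bound_topology U"
  have "\<exists>P Q. openin euclideanreal P \<and> openin order_bound_topology Q \<and> c \<in> P \<and> x \<in> Q \<and>
      P \<times> Q \<subseteq> {(c, x). c *\<^sub>R x \<in> U}" if cx: "c *\<^sub>R x \<in> U" for c :: real and x
  proof -
    obtain V where V: "V \<in> order_bound_base" "(\<lambda>v. c *\<^sub>R x + v) ` V \<subseteq> U"
      using U cx unfolding openin_order_bound_topology by blast
    have convV: "convex V" and circV: "circled V"
      using V by (auto simp: order_bound_base_def)
    obtain \<mu> where m: "\<mu> > 0" "\<And>d. \<bar>d\<bar> \<le> \<mu> \<Longrightarrow> d *\<^sub>R x \<in> V"
      using order_bound_base_absorbs_point[OF V(1)] by blast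
    define s where "s = 1 / (2 * (\<bar>c\<bar> + \<mu>))"
    have s: "s > 0" using m by (auto simp: s_def)
    have H: "(\<lambda>w. s *\<^sub>R w) ` V \<in> order_bound_base" using V s by (intro order_bound_base_scale)
    obtain Q where Q: "openin order_bound_topology Q" "x \<in> Q" "Q \<subseteq> (\<lambda>v. x + v) ` (\<lambda>w. s *\<^sub>R w) ` V"
      using order_bound_nhd_at[OF H] by blast
    have "d *\<^sub>R q \<in> U" if dq: "d \<in> ball c (\<mu>/2)" "q \<in> Q" for d q
    proof -
      obtain a where a: "a \<in> V" "q = x + s *\<^sub>R a" using Q dq by blast
      have dc: "\<bar>d - c\<bar> < \<mu>/2" using dq by (simp add: dist_real_def abs_minus_commute)
      have "\<bar>2 * (d - c)\<bar> \<le> \<mu>" using dc by (simp only: abs_mult abs_numeral) argo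
      then have 1: "(2 * (d - c)) *\<^sub>R x \<in> V" by (rule m)
      have "\<bar>d\<bar> \<le> \<bar>c\<bar> + \<mu>" using dc by linarith
      then have "\<bar>2 * d * s\<bar> \<le> 1" using m by (simp add: s_def abs_mult field_simps)
      then have 2: "(2 * d * s) *\<^sub>R a \<in> V" using circV a by (intro circledD)
      have "(1/2) *\<^sub>R ((2 * (d - c)) *\<^sub>R x) + (1/2) *\<^sub>R ((2 * d * s) *\<^sub>R a) \<in> V"
        using 1 2 convV by (intro convexD) auto
      moreover have "d *\<^sub>R q = c *\<^sub>R x +
          ((1/2) *\<^sub>R ((2 * (d - c)) *\<^sub>R x) + (1/2) *\<^sub>R ((2 * d * s) *\<^sub>R a))"
        using a by (simp add: algebra_simps)
      ultimately show ?thesis using V by (metis imageI subsetD)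
    qed
    with Q m show ?thesis by (intro exI[of _ "ball c (\<mu>/2)"] exI[of _ Q]) auto
  qed
  then show "openin (prod_topology euclideanreal order_bound_topology)
      {z \<in> topspace (prod_topology euclideanreal order_bound_topology).
        (case z of (c, x) \<Rightarrow> c *\<^sub>R x) \<in> U}"
    by (subst openin_prod_topology_alt) (auto simp: subset_iff)
qed auto

end

theory Submission
  imports Defs
begin

text \<open>The order unit \<open>u\<close> makes \<open>[-u/2, u/2]\<close> a neighbourhood of \<open>0\<close>, so it suffices to find a
  downward directed set with infimum \<open>0\<close> none of whose members lies below \<open>u/2\<close>. An infinite
  dimensional Archimedean vector lattice contains an infinite maximal set \<open>D\<close> of pairwise disjoint
  positive elements; scale each \<open>e \<in> D\<close> to \<open>s e\<close> with \<open>s e \<le> u\<close> but not \<open>s e \<le> u/2\<close>. The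
  positive elements that dominate all but finitely many of the \<open>s e\<close> form the desired set: it
  contains \<open>(u - k e)\<^sup>+\<close> for all \<open>e \<in> D\<close> and all \<open>k\<close>, so by the Archimedean property the positive
  part of a lower bound is disjoint from \<open>D\<close>, and hence vanishes by maximality. If all disjoint
  systems were finite, every positive element would dominate an atom, and a maximal disjoint system
  of atoms would be a finite spanning set.\<close>

section \<open>Disjoint elements\<close>

lemma inf_eq_0I:
  fixes x y :: "'a::{ordered_real_vector, lattice}"
  assumes "0 \<le> x" "0 \<le> y" "\<And>w. w \<le> x \<Longrightarrow> w \<le> y \<Longrightarrow> w \<le> 0"
  shows "inf x y = 0"
  using assms by (intro antisym) auto

lemma inf_eq_0_le:
  fixes x y :: "'a::{ordered_real_vector, lattice}"
  assumes "inf x y = 0" "w \<le> x" "w \<le> y"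
  shows "w \<le> 0"
  using assms by (metis le_inf_iff)

lemma inf_eq_0_nonneg:
  fixes x y :: "'a::{ordered_real_vector, lattice}"
  assumes "inf x y = 0"
  shows "0 \<le> x" "0 \<le> y"
  using assms by (metis inf_le1, metis inf_le2)

lemma inf_eq_0_mono_left:
  fixes x y :: "'a::{ordered_real_vector, lattice}"
  assumes "inf x y = 0" "0 \<le> x'" "x' \<le> x"
  shows "inf x' y = 0"
  using assms inf_eq_0_nonneg(2)[OF assms(1)]
  by (intro inf_eq_0I) (auto intro: inf_eq_0_le order_trans)

lemma inf_scaleR_eq_0:
  fixes x y :: "'a::{ordered_real_vector, lattice}"
  assumes "inf x y = 0" "0 \<le> c" "0 \<le> d"
  shows "inf (c *\<^sub>R x) (d *\<^sub>R y) = 0"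
proof (rule inf_eq_0I)
  note nn = inf_eq_0_nonneg[OF assms(1)]
  show "0 \<le> c *\<^sub>R x" "0 \<le> d *\<^sub>R y" using nn assms by (simp_all add: scaleR_nonneg_nonneg)
  fix w assume w: "w \<le> c *\<^sub>R x" "w \<le> d *\<^sub>R y"
  \<comment> \<open>Replaces both factors by a common one, so that division by it leads back to
    \<open>x\<close> and \<open>y\<close>; the summand 1 keeps it positive.\<close>
  define m where "m = c + d + 1"
  have m: "m > 0" "c \<le> m" "d \<le> m" using assms by (auto simp: m_def)
  have "w \<le> m *\<^sub>R x" "w \<le> m *\<^sub>R y"
    using w m nn by (meson order_trans scaleR_right_mono)+
  then have "w /\<^sub>R m \<le> x" "w /\<^sub>R m \<le> y"
    using m by (auto simp: pos_divideR_le_eq)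
  then have "w /\<^sub>R m \<le> 0" by (rule inf_eq_0_le[OF assms(1)])
  then show "w \<le> 0" using m by (simp add: pos_divideR_le_eq)
qed

text \<open>The two parts are at most \<open>sup x y - y\<close> and \<open>sup x y - x\<close>.
  Subtracting a common lower bound \<open>w\<close> from \<open>sup x y\<close> thus leaves an upper
  bound of \<open>x\<close> and \<open>y\<close>, which forces \<open>w \<le> 0\<close>.\<close>

lemma inf_pos_neg_part_eq_0:
  fixes x y :: "'a::{ordered_real_vector, lattice}"
  shows "inf (sup (x - y) 0) (sup (y - x) 0) = 0"
proof (rule inf_eq_0I)
  have *: "sup (a - b) 0 \<le> sup a b - b" for a b :: 'a
    by (metis (no_types) le_supI diff_right_mono diff_self sup_ge1 sup_ge2)
  fix w assume w: "w \<le> sup (x - y) 0" "w \<le> sup (y - x) 0"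
  then have "w \<le> sup x y - y" "w \<le> sup x y - x"
    using *[of x y] *[of y x] order_trans unfolding sup.commute[of y x] by blast+
  then have "y \<le> sup x y - w" "x \<le> sup x y - w"
    by (simp_all add: le_diff_eq add.commute)
  then have "sup x y \<le> sup x y - w" by (rule le_supI[rotated])
  then show "w \<le> 0" by (simp only: le_diff_eq add_le_same_cancel1)
qed auto

text \<open>The difference of the two sides lies below \<open>x\<close>, and below \<open>y\<close>
  because \<open>x \<le> u\<close>; disjointness makes it nonpositive.\<close>

lemma le_pos_part_diff:
  fixes u x y :: "'a::{ordered_real_vector, lattice}"
  assumes "inf x y = 0" "x \<le> u"
  shows "x \<le> sup (u - y) 0"
proof -
  have "x - sup (u - y) 0 \<le> x" by simp
  moreover have "x - sup (u - y) 0 \<le> x - (u - y)" by (intro diff_left_mono) simp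
  then have "x - sup (u - y) 0 \<le> y"
    using assms(2) by (metis diff_diff_eq2 diff_le_eq add_right_mono add.commute order_trans)
  ultimately have "x - sup (u - y) 0 \<le> 0" by (rule inf_eq_0_le[OF assms(1)])
  then show ?thesis by simp
qed

section \<open>Consequences of the Archimedean property\<close>

lemma archimedean_orderD:
  fixes x y :: "'a::ordered_real_vector"
  assumes "archimedean_order TYPE('a)" "0 \<le> y" "\<And>n::nat. n > 0 \<Longrightarrow> real n *\<^sub>R x \<le> y"
  shows "x \<le> 0"
proof -
  have "real n *\<^sub>R x \<le> y" for n
    using assms(2,3) by (cases "n = 0") auto
  then show ?thesis using assms(1) unfolding archimedean_order_def by blast
qed

text \<open>With \<open>w = inf z e\<close>, the element \<open>w - u/k\<close> lies below the
  positive parts of \<open>k e - u\<close> (as \<open>w \<le> e\<close>) and of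
  \<open>u - k e\<close> (as \<open>w \<le> z\<close>). These are disjoint, so
  \<open>k w \<le> u\<close> for all \<open>k > 0\<close>, and the Archimedean property
  applies.\<close>

lemma inf_eq_0_if_le_pos_parts:
  fixes u z e :: "'a::{ordered_real_vector, lattice}"
  assumes "archimedean_order TYPE('a)" "0 \<le> u" "0 \<le> z" "0 \<le> e"
    and le: "\<And>k::nat. z \<le> sup (u - real k *\<^sub>R e) 0"
  shows "inf z e = 0"
proof -
  define w where "w = inf z e"
  have w: "w \<le> z" "w \<le> e" by (auto simp: w_def)
  have "real k *\<^sub>R w \<le> u" if "k > 0" for k
  proof -
    define v where "v = w - u /\<^sub>R real k"
    have "v \<le> sup (real k *\<^sub>R e - u) 0"
    proof -
      have "real k *\<^sub>R v \<le> sup (real k *\<^sub>R e - u) 0"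
        using w that
        by (auto simp: v_def scaleR_diff_right
            intro!: le_supI1 diff_right_mono scaleR_left_mono)
      then have "v \<le> inverse (real k) *\<^sub>R sup (real k *\<^sub>R e - u) 0"
        using that by (simp add: pos_le_divideR_eq)
      also have "\<dots> \<le> 1 *\<^sub>R sup (real k *\<^sub>R e - u) 0"
        using that by (intro scaleR_right_mono) (auto simp: field_simps)
      finally show ?thesis by simp
    qed
    moreover have "v \<le> w"
      using assms(2) by (simp add: v_def scaleR_nonneg_nonneg)
    then have "v \<le> sup (u - real k *\<^sub>R e) 0" using w le order_trans by metis
    ultimately have "v \<le> 0"
      using inf_eq_0_le[OF inf_pos_neg_part_eq_0[of "u" "real k *\<^sub>R e"]] by blast
    then show ?thesis using that by (simp add: v_def pos_le_divideR_eq)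
  qed
  then have "w \<le> 0" using archimedean_orderD[OF assms(1,2)] by blast
  then show ?thesis using assms(3,4) by (auto simp: w_def intro: antisym)
qed

text \<open>The Archimedean property is used twice: it bounds the admissible coefficients, and it
  shows that their supremum is attained, since some admissible coefficient lies within
  \<open>1/n\<close> of it for every \<open>n > 0\<close>.\<close>

lemma greatest_multiple_below:
  fixes e x :: "'a::ordered_real_vector"
  assumes "archimedean_order TYPE('a)" "0 < e" "0 \<le> x"
  obtains c :: real where "0 \<le> c" "c *\<^sub>R e \<le> x" "\<And>d. d *\<^sub>R e \<le> x \<Longrightarrow> d \<le> c"
proof -
  define S where "S = {c. c *\<^sub>R e \<le> x}"
  obtain n :: nat where n: "\<not> real n *\<^sub>R e \<le> x"
    using assms archimedean_orderD[of x e] by fastforce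
  have "c \<le> real n" if "c \<in> S" for c
  proof (rule ccontr)
    assume "\<not> c \<le> real n"
    then have "real n *\<^sub>R e \<le> c *\<^sub>R e" using assms by (intro scaleR_right_mono) auto
    with that n show False by (auto simp: S_def)
  qed
  then have bdd: "bdd_above S" by (rule bdd_aboveI)
  have S0: "0 \<in> S" using assms by (simp add: S_def)
  have "Sup S *\<^sub>R e - x \<le> 0"
  proof (rule archimedean_orderD[OF assms(1), of e])
    fix n :: nat assume n: "n > 0"
    then obtain c where c: "c \<in> S" "Sup S - 1 / real n < c"
      using less_cSup_iff[of S "Sup S - 1 / real n"] S0 bdd by auto
    have "(Sup S - 1 / real n) *\<^sub>R e \<le> c *\<^sub>R e"
      using c assms by (intro scaleR_right_mono) auto
    also have "\<dots> \<le> x" using c by (simp add: S_def)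
    finally have "Sup S *\<^sub>R e - x \<le> e /\<^sub>R real n"
      by (simp add: algebra_simps inverse_eq_divide)
    then show "real n *\<^sub>R (Sup S *\<^sub>R e - x) \<le> e"
      using n by (simp add: pos_le_divideR_eq)
  qed (use assms in auto)
  then have "Sup S *\<^sub>R e \<le> x" by simp
  then show thesis
    using S0 bdd by (intro that[of "Sup S"]) (auto simp: S_def intro: cSup_upper)
qed

section \<open>Atoms\<close>

text \<open>As \<open>inf x y = 0\<close> forces \<open>x\<close> and \<open>y\<close> to be
  nonnegative, the condition is about the interval \<open>[0, e]\<close>. In the Archimedean case it
  yields atoms in the usual sense: all elements of \<open>[0, e]\<close> are multiples of
  \<open>e\<close>.\<close>

definition order_atom :: "'a::{ordered_real_vector, lattice} \<Rightarrow> bool" where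
  "order_atom e \<longleftrightarrow> 0 < e \<and> (\<forall>x y. x \<le> e \<longrightarrow> y \<le> e \<longrightarrow> inf x y = 0 \<longrightarrow> x = 0 \<or> y = 0)"

text \<open>The positive parts of \<open>w - c e\<close> and \<open>c e - w\<close> are disjoint and
  below \<open>e\<close>, so one of them vanishes and \<open>w\<close> is comparable with
  \<open>c e\<close>. If no positive multiple of \<open>e\<close> were below \<open>w\<close>, then
  \<open>w \<le> e/n\<close> for all \<open>n > 0\<close>, contradicting
  \<open>0 < w\<close>.\<close>

lemma order_atom_multiple_below:
  fixes e w :: "'a::{ordered_real_vector, lattice}"
  assumes "archimedean_order TYPE('a)" "order_atom e" "0 < w" "w \<le> e"
  obtains c :: real where "0 < c" "c *\<^sub>R e \<le> w"
proof -
  have e: "0 < e" using assms by (simp add: order_atom_def)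
  have cmp: "w \<le> c *\<^sub>R e \<or> c *\<^sub>R e \<le> w" if c: "0 < c" "c \<le> 1" for c :: real
  proof -
    have ce: "0 \<le> c *\<^sub>R e" "c *\<^sub>R e \<le> e"
      using c e scaleR_right_mono[of c 1 e] by (auto intro: scaleR_nonneg_nonneg)
    have "w - c *\<^sub>R e \<le> w" "c *\<^sub>R e - w \<le> c *\<^sub>R e" using ce assms(3) by auto
    then have "w - c *\<^sub>R e \<le> e" "c *\<^sub>R e - w \<le> e"
      using assms(4) ce(2) order_trans by blast+
    then have "sup (w - c *\<^sub>R e) 0 \<le> e" "sup (c *\<^sub>R e - w) 0 \<le> e"
      using e by auto
    then have "sup (w - c *\<^sub>R e) 0 = 0 \<or> sup (c *\<^sub>R e - w) 0 = 0"
      using assms(2) inf_pos_neg_part_eq_0 unfolding order_atom_def by blast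
    then show ?thesis by (metis diff_le_0_iff_le sup_ge1)
  qed
  have "\<exists>c>0. c *\<^sub>R e \<le> w"
  proof (rule ccontr)
    assume no: "\<not> ?thesis"
    have "real n *\<^sub>R w \<le> e" if "n > 0" for n :: nat
    proof -
      have "w \<le> (inverse (real n)) *\<^sub>R e"
        using cmp[of "inverse (real n)"] that no by (auto simp: field_simps)
      then show ?thesis using that by (simp add: pos_le_divideR_eq)
    qed
    then have "w \<le> 0" using archimedean_orderD[OF assms(1)] e less_imp_le by blast
    then show False using assms(3) by simp
  qed
  then show thesis using that by blast
qed

text \<open>Take the greatest multiple of \<open>e\<close> below \<open>x\<close>. If the remainder
  met \<open>e\<close> in a positive element, a further positive multiple of \<open>e\<close> could
  be split off.\<close>

lemma order_atom_decompose:
  fixes e x :: "'a::{ordered_real_vector, lattice}"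
  assumes "archimedean_order TYPE('a)" "order_atom e" "0 \<le> x"
  obtains c :: real where "0 \<le> c" "c *\<^sub>R e \<le> x" "inf (x - c *\<^sub>R e) e = 0"
proof -
  have e: "0 < e" using assms by (simp add: order_atom_def)
  obtain c where c: "0 \<le> c" "c *\<^sub>R e \<le> x" "\<And>d. d *\<^sub>R e \<le> x \<Longrightarrow> d \<le> c"
    using greatest_multiple_below[OF assms(1) e assms(3)] by blast
  have "inf (x - c *\<^sub>R e) e = 0"
  proof (rule ccontr)
    assume "inf (x - c *\<^sub>R e) e \<noteq> 0"
    moreover have "0 \<le> inf (x - c *\<^sub>R e) e" using c e by auto
    ultimately have "0 < inf (x - c *\<^sub>R e) e" using order_le_neq_trans by metis
    then obtain d where d: "0 < d" "d *\<^sub>R e \<le> inf (x - c *\<^sub>R e) e"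
      using order_atom_multiple_below[OF assms(1,2)] by (metis inf_le2)
    then have "(c + d) *\<^sub>R e \<le> x" by (simp add: scaleR_add_left le_diff_eq add.commute)
    then show False using c(3) d(1) by fastforce
  qed
  with c(1,2) show thesis by (rule that)
qed

text \<open>Multiples of the atoms are subtracted one after another. The remainder only shrinks, so
  disjointness from the earlier atoms persists.\<close>

lemma order_atoms_decompose:
  fixes F :: "'a::{ordered_real_vector, lattice} set"
  assumes "archimedean_order TYPE('a)" "finite F" "\<And>e. e \<in> F \<Longrightarrow> order_atom e" "0 \<le> x"
  shows "\<exists>s\<in>span F. 0 \<le> x - s \<and> (\<forall>e\<in>F. inf (x - s) e = 0)"
  using assms(2,3)
proof (induction F rule: finite_induct)
  case empty
  then show ?case using assms(4) by (auto intro: bexI[of _ 0])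
next
  case (insert e F)
  then obtain s where s: "s \<in> span F" "0 \<le> x - s" "\<forall>f\<in>F. inf (x - s) f = 0" by auto
  have e: "order_atom e" using insert by simp
  obtain c where c: "0 \<le> c" "c *\<^sub>R e \<le> x - s" "inf (x - s - c *\<^sub>R e) e = 0"
    using order_atom_decompose[OF assms(1) e s(2)] by blast
  have le: "x - s - c *\<^sub>R e \<le> x - s"
    using c(1) e by (simp add: order_atom_def scaleR_nonneg_nonneg less_imp_le)
  show ?case
  proof (intro bexI[of _ "s + c *\<^sub>R e"] conjI ballI)
    show "s + c *\<^sub>R e \<in> span (insert e F)"
      using s(1) by (intro span_add span_scale) (auto intro: span_base span_mono[THEN subsetD, of F])
    show "0 \<le> x - (s + c *\<^sub>R e)" using c by (simp add: diff_diff_eq[symmetric])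
    fix f assume "f \<in> insert e F"
    moreover have "inf (x - s - c *\<^sub>R e) f = 0" if "f \<in> F"
    proof (rule inf_eq_0_mono_left[OF _ _ le])
      show "inf (x - s) f = 0" using s(3) that by blast
      show "0 \<le> x - s - c *\<^sub>R e" using c(2) by (simp only: diff_ge_0_iff_ge)
    qed
    ultimately show "inf (x - (s + c *\<^sub>R e)) f = 0" using c(3) by (auto simp: diff_diff_eq[symmetric])
  qed
qed

section \<open>Disjoint systems\<close>

definition disjoint_system :: "'a::{ordered_real_vector, lattice} set \<Rightarrow> bool" where
  "disjoint_system D \<longleftrightarrow> (\<forall>x\<in>D. 0 < x) \<and> (\<forall>x\<in>D. \<forall>y\<in>D. x \<noteq> y \<longrightarrow> inf x y = 0)"

lemma disjoint_system_insert:
  fixes D :: "'a::{ordered_real_vector, lattice} set"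
  assumes "disjoint_system D" "0 < x" "\<And>y. y \<in> D \<Longrightarrow> inf x y = 0"
  shows "disjoint_system (insert x D)"
  using assms by (auto simp: disjoint_system_def inf.commute)

text \<open>Zorn's lemma. It is applied with \<open>P\<close> being \<open>order_atom\<close> to
  find a spanning set, and with trivial \<open>P\<close> to enlarge an infinite system.\<close>

lemma disjoint_system_maximal:
  fixes P :: "'a::{ordered_real_vector, lattice} \<Rightarrow> bool"
  assumes "disjoint_system D0" "\<And>e. e \<in> D0 \<Longrightarrow> P e"
  obtains D where "disjoint_system D" "D0 \<subseteq> D" "\<And>e. e \<in> D \<Longrightarrow> P e"
    "\<And>x. 0 < x \<Longrightarrow> P x \<Longrightarrow> (\<And>e. e \<in> D \<Longrightarrow> inf x e = 0) \<Longrightarrow> False"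
proof -
  define \<A> where "\<A> = {D. disjoint_system D \<and> D0 \<subseteq> D \<and> (\<forall>e\<in>D. P e)}"
  have "\<exists>M\<in>\<A>. \<forall>D\<in>\<A>. M \<subseteq> D \<longrightarrow> D = M"
  proof (rule subset_Zorn_nonempty)
    show "\<A> \<noteq> {}" using assms by (auto simp: \<A>_def)
    fix \<C> assume \<C>: "\<C> \<noteq> {}" "subset.chain \<A> \<C>"
    have "inf x y = 0" if xy: "x \<in> \<Union>\<C>" "y \<in> \<Union>\<C>" "x \<noteq> y" for x y
    proof -
      obtain C D where CD: "x \<in> C" "y \<in> D" "C \<in> \<C>" "D \<in> \<C>" using xy by blast
      then have "C \<subseteq> D \<or> D \<subseteq> C" "C \<in> \<A>" "D \<in> \<A>"
        using \<C> by (auto simp: subset.chain_def subset_chain_def)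
      then show ?thesis using CD xy(3) unfolding \<A>_def disjoint_system_def by blast
    qed
    moreover have "D \<in> \<A>" if "D \<in> \<C>" for D
      using \<C> that by (auto simp: subset_chain_def)
    then have "0 < x" "P x" if "x \<in> \<Union>\<C>" for x
      using that by (auto simp: \<A>_def disjoint_system_def)
    moreover have "D0 \<subseteq> \<Union>\<C>"
      using \<open>\<And>D. D \<in> \<C> \<Longrightarrow> D \<in> \<A>\<close> \<C>(1) by (auto simp: \<A>_def)
    ultimately show "\<Union>\<C> \<in> \<A>"
      by (simp add: \<A>_def disjoint_system_def)
  qed
  then obtain M where M: "M \<in> \<A>" "\<And>D. D \<in> \<A> \<Longrightarrow> M \<subseteq> D \<Longrightarrow> D = M" by blast
  show thesis
  proof (rule that[of M])
    fix x assume x: "0 < x" "P x" "\<And>e. e \<in> M \<Longrightarrow> inf x e = 0"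
    then have "insert x M \<in> \<A>" using M(1) by (auto simp: \<A>_def intro: disjoint_system_insert)
    then have "x \<in> M" using M(2)[of "insert x M"] by blast
    \<comment> \<open>As a member of \<open>M\<close>, \<open>x\<close> would be disjoint from
      itself and hence 0.\<close>
    then show False using x by fastforce
  qed (use M(1) in \<open>auto simp: \<A>_def\<close>)
qed

text \<open>Without atoms below \<open>x\<close>, every \<open>y\<close> in \<open>(0, x]\<close>
  dominates two disjoint positive elements \<open>f y\<close> and \<open>g y\<close>. Iterating
  \<open>f\<close> from \<open>x\<close> and collecting the pieces \<open>g\<close> at each stage
  gives an infinite disjoint system.\<close>

lemma order_atom_below:
  fixes x :: "'a::{ordered_real_vector, lattice}"
  assumes fin: "\<And>D::'a set. disjoint_system D \<Longrightarrow> finite D" and "0 < x"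
  obtains e where "order_atom e" "e \<le> x"
proof (rule ccontr)
  assume "\<not> thesis"
  then have no: "\<not> order_atom e" if "e \<le> x" for e
    using that \<open>\<And>e. order_atom e \<Longrightarrow> e \<le> x \<Longrightarrow> thesis\<close> by blast
  have "\<exists>a b. 0 < a \<and> 0 < b \<and> a \<le> y \<and> b \<le> y \<and> inf a b = 0" if y: "0 < y" "y \<le> x" for y
  proof -
    obtain a b where "a \<le> y" "b \<le> y" "inf a b = 0" "a \<noteq> 0" "b \<noteq> 0"
      using no[OF y(2)] y(1) unfolding order_atom_def by blast
    then show ?thesis using inf_eq_0_nonneg[of a b] by (intro exI[of _ a] exI[of _ b]) auto
  qed
  then have "\<forall>y. \<exists>a b. 0 < y \<and> y \<le> x \<longrightarrow>
      0 < a \<and> 0 < b \<and> a \<le> y \<and> b \<le> y \<and> inf a b = 0" by blast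
  then obtain f g where "\<forall>y. 0 < y \<and> y \<le> x \<longrightarrow>
      0 < f y \<and> 0 < g y \<and> f y \<le> y \<and> g y \<le> y \<and> inf (f y) (g y) = 0"
    unfolding choice_iff by blast
  then have fg: "0 < f y" "0 < g y" "f y \<le> y" "g y \<le> y" "inf (f y) (g y) = 0"
    if "0 < y" "y \<le> x" for y using that by blast+
  define s where "s n = (f ^^ n) x" for n
  have s: "0 < s n \<and> s n \<le> x" for n
  proof (induction n)
    case (Suc n)
    then show ?case using fg(1,3)[of "s n"] by (auto simp: s_def)
  qed (use assms in \<open>auto simp: s_def\<close>)
  have fs: "inf (f (s n)) (g (s n)) = 0" "0 < g (s n)" for n
    using fg(2,5)[of "s n"] s[of n] by blast+
  have "s (Suc n) \<le> s n" for n using fg(3)[of "s n"] s by (simp add: s_def)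
  then have anti: "s n \<le> s m" if "m \<le> n" for m n using that by (rule lift_Suc_antimono_le)
  \<comment> \<open>Since \<open>s (Suc m)\<close> is \<open>f (s m)\<close>, every later piece lies
    below \<open>f (s m)\<close>, which is disjoint from \<open>g (s m)\<close>.\<close>
  have disj: "inf (g (s m)) (g (s n)) = 0" if "m < n" for m n
  proof -
    have "g (s n) \<le> s n" using fg(4) s by blast
    also have "\<dots> \<le> f (s m)" using anti[of "Suc m" n] that by (simp add: s_def)
    finally have "inf (g (s n)) (g (s m)) = 0"
      using fs(2)[of n]
      by (intro inf_eq_0_mono_left[OF fs(1)[of m]]) auto
    then show ?thesis by (simp add: inf.commute)
  qed
  have disj': "inf (g (s m)) (g (s n)) = 0" if "m \<noteq> n" for m n
    using disj[of m n] disj[of n m] that by (cases m n rule: linorder_cases) (auto simp: inf.commute)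
  have "inj (\<lambda>n. g (s n))"
  proof (rule injI, rule ccontr)
    fix m n assume "g (s m) = g (s n)" "m \<noteq> n"
    then show False using disj'[of m n] fs(2)[of n] by simp
  qed
  then have "infinite (range (\<lambda>n. g (s n)))" by (simp add: range_inj_infinite)
  moreover have "disjoint_system (range (\<lambda>n. g (s n)))"
    unfolding disjoint_system_def
  proof (intro conjI ballI impI)
    fix a b assume "a \<in> range (\<lambda>n. g (s n))" "b \<in> range (\<lambda>n. g (s n))" "a \<noteq> b"
    then obtain m n where "a = g (s m)" "b = g (s n)" "m \<noteq> n" by blast
    then show "inf a b = 0" using disj' by simp
  qed (use fs(2) in blast)
  ultimately show False using fin by blast
qed

text \<open>Otherwise a maximal disjoint system \<open>F\<close> of atoms is finite. Modulo
  \<open>span F\<close>, a positive element reduces to a remainder disjoint from \<open>F\<close>;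
  if nonzero, it would dominate an atom that enlarges \<open>F\<close>.\<close>

lemma infinite_disjoint_system:
  assumes "archimedean_order TYPE('a::{ordered_real_vector, lattice})"
    and "infinite_dimensional TYPE('a::{ordered_real_vector, lattice})"
  obtains D :: "'a::{ordered_real_vector, lattice} set" where "disjoint_system D" "infinite D"
proof (rule ccontr)
  assume "\<not> thesis"
  then have fin: "finite D" if "disjoint_system D" for D :: "'a set"
    using that \<open>\<And>D. disjoint_system D \<Longrightarrow> infinite D \<Longrightarrow> thesis\<close> by blast
  obtain F :: "'a set" where F: "disjoint_system F" "\<And>e. e \<in> F \<Longrightarrow> order_atom e"
    and max: "\<And>x. 0 < x \<Longrightarrow> order_atom x \<Longrightarrow> (\<And>e. e \<in> F \<Longrightarrow> inf x e = 0) \<Longrightarrow> False"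
    by (rule disjoint_system_maximal[of "{}" order_atom]) (auto simp: disjoint_system_def)
  have pos: "x \<in> span F" if x: "0 \<le> x" for x
  proof -
    obtain s where s: "s \<in> span F" "0 \<le> x - s" "\<forall>e\<in>F. inf (x - s) e = 0"
      using order_atoms_decompose[OF assms(1) fin[OF F(1)] F(2) x] by blast
    have "x - s = 0"
    proof (rule ccontr)
      assume "x - s \<noteq> 0"
      then have "0 < x - s" using s(2) by simp
      then obtain a where a: "order_atom a" "a \<le> x - s" using order_atom_below[OF fin] by blast
      have a0: "0 < a" using a by (simp add: order_atom_def)
      show False
      proof (rule max[OF a0 a(1)])
        fix e assume "e \<in> F"
        then have "inf (x - s) e = 0" using s(3) by blast
        then show "inf a e = 0" by (rule inf_eq_0_mono_left[OF _ less_imp_le[OF a0] a(2)])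
      qed
    qed
    then show ?thesis using s(1) by simp
  qed
  have "x \<in> span F" for x
  proof -
    \<comment> \<open>Positive part minus negative part.\<close>
    have "sup x 0 - (sup x 0 - x) \<in> span F" by (intro span_diff pos) auto
    then show ?thesis by simp
  qed
  then have "span F = UNIV" by blast
  then show False using assms(2) fin[OF F(1)] by (auto simp: infinite_dimensional_def)
qed

section \<open>Order units\<close>

text \<open>The greatest \<open>c\<close> with \<open>c e \<le> u\<close> works:
  \<open>e \<le> n u\<close> gives \<open>c \<ge> 1/n\<close>, and \<open>c e \<le> u/2\<close>
  would make \<open>2 c\<close> admissible.\<close>

lemma order_unit_normalize:
  fixes u e :: "'a::ordered_real_vector"
  assumes "archimedean_order TYPE('a)" "order_unit u" "0 < e"
  obtains c where "0 < c" "c *\<^sub>R e \<le> u" "\<not> c *\<^sub>R e \<le> (1/2) *\<^sub>R u"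
proof -
  have u: "0 \<le> u" using assms by (simp add: order_unit_def)
  obtain c where c: "0 \<le> c" "c *\<^sub>R e \<le> u" "\<And>d. d *\<^sub>R e \<le> u \<Longrightarrow> d \<le> c"
    using greatest_multiple_below[OF assms(1,3) u] by blast
  obtain n :: nat where n: "e \<le> real n *\<^sub>R u" using assms(2) by (auto simp: order_unit_def)
  have "n > 0" using n assms(3) by (cases n) auto
  then have "inverse (real n) *\<^sub>R e \<le> u" using n by (simp add: pos_divideR_le_eq)
  then have "inverse (real n) \<le> c" by (rule c(3))
  then have c0: "0 < c"
    using \<open>n > 0\<close> by (meson inverse_positive_iff_positive less_le_trans of_nat_0_less_iff)
  have "\<not> c *\<^sub>R e \<le> (1/2) *\<^sub>R u"
  proof
    assume "c *\<^sub>R e \<le> (1/2) *\<^sub>R u"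
    then have "2 *\<^sub>R (c *\<^sub>R e) \<le> 2 *\<^sub>R ((1/2) *\<^sub>R u)" by (intro scaleR_left_mono) auto
    then have "2 * c \<le> c" using c(3)[of "2 * c"] by simp
    with c0 show False by simp
  qed
  with c c0 show thesis using that by blast
qed

lemma order_unit_interval_in_base:
  fixes u :: "'a::ordered_real_vector"
  assumes "order_unit u" "0 < \<epsilon>"
  shows "{- (\<epsilon> *\<^sub>R u)..\<epsilon> *\<^sub>R u} \<in> order_bound_base"
proof -
  have u: "0 \<le> u" using assms by (simp add: order_unit_def)
  \<comment> \<open>Used with \<open>M = \<epsilon>\<close> for circledness and with the bound of an
    order interval for absorption.\<close>
  have scale: "c *\<^sub>R x \<in> {- (\<epsilon> *\<^sub>R u)..\<epsilon> *\<^sub>R u}"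
    if x: "- (M *\<^sub>R u) \<le> x" "x \<le> M *\<^sub>R u" and c: "\<bar>c\<bar> * M \<le> \<epsilon>" for c M x
  proof -
    have 1: "(\<bar>c\<bar> * M) *\<^sub>R u \<le> \<epsilon> *\<^sub>R u" using c u by (rule scaleR_right_mono)
    have 2: "\<bar>c\<bar> *\<^sub>R x \<le> (\<bar>c\<bar> * M) *\<^sub>R u"
      using scaleR_left_mono[OF x(2), of "\<bar>c\<bar>"] by simp
    have 3: "- (\<bar>c\<bar> *\<^sub>R x) \<le> (\<bar>c\<bar> * M) *\<^sub>R u"
      using scaleR_left_mono[OF x(1), of "\<bar>c\<bar>"] by (simp add: minus_le_iff)
    have "\<bar>c\<bar> *\<^sub>R x \<le> \<epsilon> *\<^sub>R u" "- (\<bar>c\<bar> *\<^sub>R x) \<le> \<epsilon> *\<^sub>R u"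
      using 1 2 3 by (auto intro: order_trans)
    then show ?thesis by (cases "c \<ge> 0") (auto simp: minus_le_iff)
  qed
  have "convex {- (\<epsilon> *\<^sub>R u)..\<epsilon> *\<^sub>R u}"
  proof (rule convexI)
    fix x y :: 'a and a b :: real
    assume xy: "x \<in> {- (\<epsilon> *\<^sub>R u)..\<epsilon> *\<^sub>R u}" "y \<in> {- (\<epsilon> *\<^sub>R u)..\<epsilon> *\<^sub>R u}"
      and ab: "0 \<le> a" "0 \<le> b" "a + b = 1"
    have "a *\<^sub>R x + b *\<^sub>R y \<le> a *\<^sub>R (\<epsilon> *\<^sub>R u) + b *\<^sub>R (\<epsilon> *\<^sub>R u)"
      using xy ab by (intro add_mono scaleR_left_mono) auto
    moreover have "a *\<^sub>R (- (\<epsilon> *\<^sub>R u)) + b *\<^sub>R (- (\<epsilon> *\<^sub>R u)) \<le> a *\<^sub>R x + b *\<^sub>R y"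
      using xy ab by (intro add_mono scaleR_left_mono) auto
    ultimately show "a *\<^sub>R x + b *\<^sub>R y \<in> {- (\<epsilon> *\<^sub>R u)..\<epsilon> *\<^sub>R u}"
      using ab(3) by (simp only: scaleR_left_distrib[symmetric] scaleR_one atLeastAtMost_iff)
  qed
  moreover have "circled {- (\<epsilon> *\<^sub>R u)..\<epsilon> *\<^sub>R u}"
    unfolding circled_def
  proof (intro ballI image_subsetI)
    fix c :: real and x assume "c \<in> {-1..1}" "x \<in> {- (\<epsilon> *\<^sub>R u)..\<epsilon> *\<^sub>R u}"
    then show "c *\<^sub>R x \<in> {- (\<epsilon> *\<^sub>R u)..\<epsilon> *\<^sub>R u}"
      using assms(2) by (intro scale[of \<epsilon>]) (auto simp: abs_le_iff mult_left_le_one_le)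
  qed
  moreover have "absorbs {- (\<epsilon> *\<^sub>R u)..\<epsilon> *\<^sub>R u} {a..b}" for a b
  proof -
    obtain m n :: nat where mn: "- a \<le> real m *\<^sub>R u" "b \<le> real n *\<^sub>R u"
      using assms(1) unfolding order_unit_def by blast
    \<comment> \<open>The summand 1 keeps \<open>M\<close> positive when \<open>m\<close> and
      \<open>n\<close> are both 0.\<close>
    define M where "M = real m + real n + 1"
    have M: "M > 0" "real m *\<^sub>R u \<le> M *\<^sub>R u" "real n *\<^sub>R u \<le> M *\<^sub>R u"
      using u by (auto simp: M_def intro!: scaleR_right_mono)
    have ab: "- (M *\<^sub>R u) \<le> a" "b \<le> M *\<^sub>R u"
      using mn M order_trans[OF mn(1) M(2)] by (auto simp: minus_le_iff)
    show ?thesis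
      unfolding absorbs_def
    proof (intro exI[of _ "\<epsilon> / M"] conjI ballI image_subsetI)
      show "0 < \<epsilon> / M" using M assms(2) by simp
      fix c x assume "c \<in> {- (\<epsilon> / M)..\<epsilon> / M}" "x \<in> {a..b}"
      then show "c *\<^sub>R x \<in> {- (\<epsilon> *\<^sub>R u)..\<epsilon> *\<^sub>R u}"
        using ab M(1) by (intro scale[of M]) (auto simp: field_simps abs_if intro: order_trans)
    qed
  qed
  ultimately show ?thesis by (simp add: order_bound_base_def)
qed

section \<open>Construction of the net\<close>

theorem corollary10p3:
  assumes "infinite_dimensional TYPE('a::{ordered_real_vector, lattice})"
    and "archimedean_order TYPE('a)"
    and "\<exists>u::'a. order_unit u"
  shows "\<exists>(A::'a set) (r::'a rel) (x::'a \<Rightarrow> 'a).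
           directed_on A r \<and> net_decreases_to_0 A r x \<and>
           \<not> limitin order_bound_topology x 0 (net_filter A r)"
proof -
  obtain u :: 'a where u: "order_unit u" using assms(3) by blast
  then have u0: "0 \<le> u" by (simp add: order_unit_def)
  obtain D0 :: "'a set" where D0: "disjoint_system D0" "infinite D0"
    using infinite_disjoint_system[OF assms(2,1)] by blast
  obtain D where D: "disjoint_system D" "D0 \<subseteq> D"
    and max: "\<And>x. 0 < x \<Longrightarrow> (\<And>e. e \<in> D \<Longrightarrow> inf x e = 0) \<Longrightarrow> False"
    by (rule disjoint_system_maximal[OF D0(1), of "\<lambda>_. True"]) auto
  have infD: "infinite D" using D(2) D0(2) finite_subset by blast
  have posD: "0 < e" if "e \<in> D" for e using D(1) that by (simp add: disjoint_system_def)
  have "\<exists>c>0. c *\<^sub>R e \<le> u \<and> \<not> c *\<^sub>R e \<le> (1/2) *\<^sub>R u" if "e \<in> D" for e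
    using order_unit_normalize[OF assms(2) u posD[OF that]] by metis
  then obtain c where c: "0 < c e" "c e *\<^sub>R e \<le> u" "\<not> c e *\<^sub>R e \<le> (1/2) *\<^sub>R u"
    if "e \<in> D" for e by metis
  define A where "A = {y. 0 \<le> y \<and> finite {e\<in>D. \<not> c e *\<^sub>R e \<le> y}}"
  \<comment> \<open>Smaller elements come later, so the identity on \<open>A\<close> is a decreasing
    net.\<close>
  define r where "r = {(a, b) \<in> A \<times> A. b \<le> a}"
  have "u \<in> A"
  proof -
    have "{e\<in>D. \<not> c e *\<^sub>R e \<le> u} = {}" using c(2) by blast
    then have "finite {e\<in>D. \<not> c e *\<^sub>R e \<le> u}" by (simp only: finite.emptyI)
    then show ?thesis using u0 unfolding A_def by blast
  qed
  \<comment> \<open>The exceptional set of an infimum is the union of the two exceptional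
    sets.\<close>
  moreover have "inf a b \<in> A" if "a \<in> A" "b \<in> A" for a b
  proof -
    have "{e\<in>D. \<not> c e *\<^sub>R e \<le> inf a b} = {e\<in>D. \<not> c e *\<^sub>R e \<le> a} \<union> {e\<in>D. \<not> c e *\<^sub>R e \<le> b}"
      by auto
    then show ?thesis using that by (simp add: A_def)
  qed
  ultimately have dir: "directed_on A r"
    unfolding directed_on_def preorder_on_def r_def
    by (auto simp: refl_on_def trans_def intro: order_trans inf_le1 inf_le2)
  have large: "\<not> y \<le> (1/2) *\<^sub>R u" if "y \<in> A" for y
  proof
    assume y: "y \<le> (1/2) *\<^sub>R u"
    have "\<not> D \<subseteq> {e\<in>D. \<not> c e *\<^sub>R e \<le> y}"
      using that infD finite_subset unfolding A_def by blast
    then obtain e where "e \<in> D" "c e *\<^sub>R e \<le> y" by blast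
    then show False using c(3) y order_trans by blast
  qed
  have "z \<le> 0" if z: "\<And>y. y \<in> A \<Longrightarrow> z \<le> y" for z
  proof (rule ccontr)
    assume "\<not> z \<le> 0"
    \<comment> \<open>Still a lower bound of \<open>A\<close>, because the members of
      \<open>A\<close> are nonnegative.\<close>
    define w where "w = sup z 0"
    have w: "0 \<le> w" "w \<noteq> 0" using \<open>\<not> z \<le> 0\<close> by (auto simp: w_def) (metis sup_ge1)
    have wA: "w \<le> y" if "y \<in> A" for y
      using z[OF that] that by (auto simp: w_def A_def)
    have "inf w e = 0" if e: "e \<in> D" for e
    proof (rule inf_eq_0_if_le_pos_parts[OF assms(2) u0 w(1)])
      show "0 \<le> e" using posD[OF e] by simp
      fix k :: nat
      \<comment> \<open>Only \<open>e\<close> itself can be exceptional for this positive part,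
        which therefore belongs to \<open>A\<close>.\<close>
      have "c f *\<^sub>R f \<le> sup (u - real k *\<^sub>R e) 0" if f: "f \<in> D" "f \<noteq> e" for f
      proof (rule le_pos_part_diff[OF _ c(2)[OF f(1)]])
        have "inf f e = 0" using D(1) e f by (simp add: disjoint_system_def)
        then show "inf (c f *\<^sub>R f) (real k *\<^sub>R e) = 0"
          using c(1)[OF f(1)] by (intro inf_scaleR_eq_0) auto
      qed
      then have "{f\<in>D. \<not> c f *\<^sub>R f \<le> sup (u - real k *\<^sub>R e) 0} \<subseteq> {e}" by blast
      then have "finite {f\<in>D. \<not> c f *\<^sub>R f \<le> sup (u - real k *\<^sub>R e) 0}"
        using finite_subset by blast
      then show "w \<le> sup (u - real k *\<^sub>R e) 0" by (intro wA) (simp add: A_def)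
    qed
    moreover have "0 < w" using w order_le_neq_trans by metis
    ultimately show False using max by blast
  qed
  then have dec: "net_decreases_to_0 A r (\<lambda>y. y)"
    by (auto simp: net_decreases_to_0_def isGlb_UNIV_iff r_def A_def)
  have "\<not> limitin order_bound_topology (\<lambda>y. y) 0 (net_filter A r)"
  proof
    assume lim: "limitin order_bound_topology (\<lambda>y. y) 0 (net_filter A r)"
    obtain U where U: "openin order_bound_topology U" "0 \<in> U"
      "U \<subseteq> {- ((1/2) *\<^sub>R u)..(1/2) *\<^sub>R u}"
      using openin_order_bound_interior[OF order_unit_interval_in_base[OF u, of "1/2"]] by auto
    \<comment> \<open>Convergence would put a member of \<open>A\<close> below \<open>u/2\<close>,
      against \<open>large\<close>.\<close>
    have "eventually (\<lambda>y. y \<in> U) (net_filter A r)"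
      using lim U unfolding limitin_def by blast
    then obtain a where "a \<in> A" "a \<in> U"
      unfolding eventually_net_filter[OF dir] by (auto simp: r_def)
    then show False using large U(3) by auto
  qed
  with dir dec show ?thesis by blast
qed

end
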